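(* Let $g$ and $h$ be normalized positive valued arithmetic functions. Let $x,y\in\mathbb{C}\setminus\{0\}$. Then for all $n\geq 1$ $$\frac{h(n)}{y}\,P_n^{g,h}(y)-\frac{1}{x}\,Q_n^g(x)=\sum_{k=1}^{n-1}\left(\frac{1}{x}-\frac{h(k)}{y}\right)P_k^{g,h}(y)\,Q_{n-k}^g(x).$$
   Context: $\mathbb{N}=\{1,2,3,\dots\}$. An arithmetic function $f:\mathbb{N}\to\mathbb{R}$ is normalized if $f(1)=1$. For normalized positive valued arithmetic functions $g,h$, define polynomials by $P_0^{g,h}(z)=1$ and $$P_n^{g,h}(z)=\frac{z}{h(n)}\sum_{k=1}^n g(k)\,P_{n-k}^{g,h}(z),\qquad n\geq 1.$$ Let $Q_n^g(z)$ be the case where $h$ is the constant function $1$, i.e. $Q_0^g(z)=1$ and $Q_n^g(z)=z\sum_{k=1}^n g(k)\,Q_{n-k}^g(z)$ for $n\geq 1$. An empty sum is $0$. *)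

theory Defs
  imports Complex_Main "HOL-Computational_Algebra.Polynomial"
begin

text \<open>
  Arithmetic functions live on the positive integers. They are rendered as functions on
  \<^typ>\<open>nat\<close> whose (arbitrary) value at \<open>0\<close> is never constrained and never used.
\<close>

definition normalized :: "(nat \<Rightarrow> real) \<Rightarrow> bool" where
  "normalized f \<longleftrightarrow> f 1 = 1"

definition positive_valued :: "(nat \<Rightarrow> real) \<Rightarrow> bool" where
  "positive_valued f \<longleftrightarrow> (\<forall>n\<ge>1. f n > 0)"

text \<open>
  The coefficients are real; the polynomials are taken over the complex numbers because they
  are evaluated at complex arguments. The factor \<open>[:0, 1 / c:]\<close> is the polynomial \<open>z / c\<close>.
\<close>

fun P :: "(nat \<Rightarrow> real) \<Rightarrow> (nat \<Rightarrow> real) \<Rightarrow> nat \<Rightarrow> complex poly" where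
  "P g h 0 = 1"
| "P g h (Suc n) = [:0, 1 / complex_of_real (h (Suc n)):] *
     (\<Sum>k = 1..Suc n. smult (complex_of_real (g k)) (P g h (Suc n - k)))"

definition Q :: "(nat \<Rightarrow> real) \<Rightarrow> nat \<Rightarrow> complex poly" where
  "Q g = P g (\<lambda>_. 1)"

end

theory Submission
  imports Defs "HOL-Computational_Algebra.Formal_Power_Series"
begin

unbundle fps_syntax

text \<open>
  Let \<open>p\<close>, \<open>q\<close> and \<open>G\<close> be the generating functions of \<open>P\<^sub>n(y)\<close>, \<open>Q\<^sub>n(x)\<close> and \<open>g\<close> (without constant term).
  The recursions say that \<open>G p\<close> and \<open>G q\<close> have the coefficients \<open>h(n) P\<^sub>n(y) / y\<close> and \<open>Q\<^sub>n(x) / x\<close>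
  for \<open>n \<ge> 1\<close>, and constant term zero. The identity compares the coefficients of
  \<open>(G p) q = p (G q)\<close>.
\<close>

text \<open>The value \<open>g 0\<close> is arbitrary; zero in its place makes the convolution start
  at \<open>k = 1\<close>, as in the recursion.\<close>

definition arith_fps :: "(nat \<Rightarrow> real) \<Rightarrow> complex fps" where
  "arith_fps g = Abs_fps (\<lambda>k. if k = 0 then 0 else complex_of_real (g k))"

definition P_fps :: "(nat \<Rightarrow> real) \<Rightarrow> (nat \<Rightarrow> real) \<Rightarrow> complex \<Rightarrow> complex fps" where
  "P_fps g h z = Abs_fps (\<lambda>n. poly (P g h n) z)"

lemma arith_fps_mult_P_fps_nth_0: "(arith_fps g * P_fps g h z) $ 0 = 0"
  by (simp add: arith_fps_def)

text \<open>The recursion at \<open>z\<close>, solved for its convolution sum. Taking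
  \<open>h\<close> constantly 1 covers \<open>Q\<close>.\<close>

lemma arith_fps_mult_P_fps_nth:
  assumes "n \<ge> 1" and "h n \<noteq> 0" and "z \<noteq> 0"
  shows "(arith_fps g * P_fps g h z) $ n = complex_of_real (h n) / z * poly (P g h n) z"
proof -
  obtain m where n: "n = Suc m"
    using assms(1) by (cases n) auto
  have "(arith_fps g * P_fps g h z) $ n
      = (\<Sum>k = 1..n. complex_of_real (g k) * poly (P g h (n - k)) z)"
    by (simp add: fps_mult_nth arith_fps_def P_fps_def sum.atLeast_Suc_atMost)
  also have "\<dots> = complex_of_real (h n) / z * poly (P g h n) z"
    using assms(2,3) by (simp add: n poly_sum del: sum.cl_ivl_Suc)
  finally show ?thesis .
qed

theorem lemma1p6:
  fixes g h :: "nat \<Rightarrow> real" and x y :: complex and n :: nat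
  assumes "normalized g" and "positive_valued g"
    and "normalized h" and "positive_valued h"
    and "x \<noteq> 0" and "y \<noteq> 0"
    and "n \<ge> 1"
  shows "complex_of_real (h n) / y * poly (P g h n) y - 1 / x * poly (Q g n) x =
    (\<Sum>k = 1..n - 1. (1 / x - complex_of_real (h k) / y) * poly (P g h k) y * poly (Q g (n - k)) x)"
proof -
  define G p q where "G = arith_fps g" and "p = P_fps g h y" and "q = P_fps g (\<lambda>_. 1) x"
  have h: "h k \<noteq> 0" if "k \<ge> 1" for k
    using assms(4) that by (force simp: positive_valued_def)
  have p: "p $ k = poly (P g h k) y" and q: "q $ k = poly (Q g k) x" for k
    by (simp_all add: p_def q_def P_fps_def Q_def)
  have p0: "p $ 0 = 1" and q0: "q $ 0 = 1"
    by (simp_all add: p q Q_def)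
  have Gp0: "(G * p) $ 0 = 0" and Gq0: "(G * q) $ 0 = 0"
    unfolding G_def p_def q_def by (rule arith_fps_mult_P_fps_nth_0)+
  have Gp: "(G * p) $ k = complex_of_real (h k) / y * p $ k" if "k \<ge> 1" for k
    unfolding p using arith_fps_mult_P_fps_nth[of k h y g] that h[OF that] assms(6)
    by (simp add: G_def p_def)
  have Gq: "(G * q) $ k = 1 / x * q $ k" if "k \<ge> 1" for k
    unfolding q using arith_fps_mult_P_fps_nth[of k "\<lambda>_. 1" x g] that assms(5)
    by (simp add: G_def q_def Q_def)
  have split_sum: "(\<Sum>k = 0..n. f k) = f 0 + (\<Sum>k = 1..n - 1. f k) + f n" for f :: "nat \<Rightarrow> complex"
    using assms(7) by (cases n) (simp_all add: sum.atLeast_Suc_atMost)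
  have "((G * p) * q) $ n = (p * (G * q)) $ n"
    by (simp add: mult_ac)
  \<comment> \<open>On each side one end term vanishes by \<open>Gp0\<close> or \<open>Gq0\<close>,
    and the other has a factor \<open>q $ 0 = 1\<close> or \<open>p $ 0 = 1\<close>.\<close>
  then have "(\<Sum>k = 1..n - 1. (G * p) $ k * q $ (n - k)) + (G * p) $ n
      = (G * q) $ n + (\<Sum>k = 1..n - 1. p $ k * (G * q) $ (n - k))"
    unfolding fps_mult_nth[of "G * p" q] fps_mult_nth[of p "G * q"] split_sum
    using p0 q0 Gp0 Gq0 by simp
  then have "(G * p) $ n - (G * q) $ n
      = (\<Sum>k = 1..n - 1. p $ k * (G * q) $ (n - k) - (G * p) $ k * q $ (n - k))"
    by (simp add: sum_subtractf algebra_simps)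
  \<comment> \<open>For \<open>k\<close> in \<open>1..n - 1\<close> both \<open>k\<close> and
    \<open>n - k\<close> are at least 1, so \<open>Gp\<close> and \<open>Gq\<close> apply to every
    summand.\<close>
  also have "\<dots> = (\<Sum>k = 1..n - 1. (1 / x - complex_of_real (h k) / y) * p $ k * q $ (n - k))"
    by (rule sum.cong) (auto simp: Gp Gq algebra_simps)
  finally show ?thesis
    using assms(7) by (simp add: Gp Gq p q)
qed

end
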